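(* Let $G$ be a connected finite simple graph and let $k \geq 2$ be an integer. Let $S \subseteq V(G)$ be such that $\alpha_G(S) \leq k + \kappa_G(S) - 1$. Then $G$ has a $k$-ended tree covering $S$; that is, there is a subgraph $T$ of $G$ which is a tree with at most $k$ leaves and satisfies $S \subseteq V(T)$.
   Context: All graphs are finite and simple. For a graph $G$ and $S \subseteq V(G)$, $\alpha_G(S)$ denotes the maximum cardinality of a subset of $S$ that is independent in $G$ (no two of its vertices are adjacent in $G$). For two distinct vertices $x, y$ of $G$, the local connectivity $\kappa_G(x,y)$ is the maximum number of pairwise internally disjoint paths connecting $x$ and $y$ in $G$ (if $x,y$ are adjacent, the edge $xy$ counts as one such path). Define $\kappa_G(S) := \min\{\kappa_G(x,y) : x,y \in S,\ x \neq y\}$ if $|S| \geq 2$, and $\kappa_G(S) := +\infty$ if $|S| \leq 1$. A leaf of a tree $T$ is a vertex of degree one in $T$. A $k$-ended tree is a tree having at most $k$ leaves. A tree $T$ in $G$ (a subgraph of $G$ that is a tree, not necessarily spanning) covers $S$ if $S \subseteq V(T)$. *)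

theory Defs
  imports "Graph_Theory.Kuratowski" "HOL-Library.Extended_Nat"
begin

text \<open>
  A finite simple graph is a \<open>pair_graph\<close>: a finite vertex set with a symmetric, loop-free
  adjacency relation \<open>parcs\<close>, so each undirected edge is present as two opposite arcs.
\<close>

definition independent :: "'a pair_pre_digraph \<Rightarrow> 'a set \<Rightarrow> bool" where
  "independent G X \<longleftrightarrow> X \<subseteq> pverts G \<and> (\<forall>u\<in>X. \<forall>v\<in>X. (u, v) \<notin> parcs G)"

definition independence_number :: "'a pair_pre_digraph \<Rightarrow> 'a set \<Rightarrow> nat" where
  "independence_number G S = Max {card X | X. X \<subseteq> S \<and> independent G X}"

text \<open>
  Paths are lists of arcs. In a simple graph two distinct paths between the same two distinct
  vertices cannot both have no inner vertices, so the edge \<open>xy\<close> contributes at most one path.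
\<close>

definition internally_disjoint_paths ::
    "'a pair_pre_digraph \<Rightarrow> 'a \<Rightarrow> 'a \<Rightarrow> ('a \<times> 'a) awalk set \<Rightarrow> bool" where
  "internally_disjoint_paths G x y P \<longleftrightarrow>
     (\<forall>p\<in>P. pre_digraph.apath (with_proj G) x p y) \<and>
     (\<forall>p\<in>P. \<forall>q\<in>P. p \<noteq> q \<longrightarrow>
        set (pre_digraph.inner_verts (with_proj G) p) \<inter>
        set (pre_digraph.inner_verts (with_proj G) q) = {})"

text \<open>Only meaningful for distinct vertices of a finite graph.\<close>

definition local_connectivity :: "'a pair_pre_digraph \<Rightarrow> 'a \<Rightarrow> 'a \<Rightarrow> nat" where
  "local_connectivity G x y = Max {card P | P. internally_disjoint_paths G x y P}"

definition set_connectivity :: "'a pair_pre_digraph \<Rightarrow> 'a set \<Rightarrow> enat" where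
  "set_connectivity G S =
     (if card S \<ge> 2
      then enat (Min {local_connectivity G x y | x y. x \<in> S \<and> y \<in> S \<and> x \<noteq> y})
      else \<infinity>)"

text \<open>
  The constant \<open>tree\<close> of \<open>Digraph_Component\<close> is not usable for symmetric digraphs: it counts
  the two opposite arcs of a single edge as a cycle. Undirected cycles are the directed cycles
  of length at least three. Connected graphs are nonempty by definition.
\<close>

definition undirected_tree :: "'a pair_pre_digraph \<Rightarrow> bool" where
  "undirected_tree T \<longleftrightarrow> pair_graph T \<and> connected (with_proj T) \<and>
     \<not> (\<exists>p. pre_digraph.cycle (with_proj T) p \<and> length p \<ge> 3)"

text \<open>In a symmetric digraph the out-degree is the degree of the undirected graph.\<close>

definition leaves :: "'a pair_pre_digraph \<Rightarrow> 'a set" where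
  "leaves T = {v \<in> pverts T. out_degree (with_proj T) v = 1}"

definition k_ended_tree :: "nat \<Rightarrow> 'a pair_pre_digraph \<Rightarrow> bool" where
  "k_ended_tree k T \<longleftrightarrow> undirected_tree T \<and> card (leaves T) \<le> k"

end

theory Submission
  imports Defs
begin

text \<open>
  Write \<open>\<alpha>\<close> for the independence number and let any two distinct vertices of \<open>S\<close> be joined by \<open>m\<close>
  internally disjoint paths. The proof has two parts.

  First, there is a path \<open>p\<close> with \<open>\<alpha> (S - p) \<le> \<alpha> S - (m + 1)\<close>
  (\<open>path_reducing_independence\<close>). This is a variant of Kouider's strengthening of the
  Chvatal-Erdos theorem. By induction on \<open>S\<close> one may assume that a path \<open>p\<close> misses a vertex
  \<open>v \<in> S\<close> whose omission is the only reason that \<open>p\<close> fails. The \<open>m\<close> paths from \<open>v\<close> to the first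
  vertex of \<open>p\<close> give a fan from \<open>v\<close> to \<open>p\<close>. The Chvatal-Erdos argument takes the successors of the feet
  of such a fan as an independent set; here the successors are replaced by segments behind
  the feet, each just long enough to raise the independence number of the set \<open>Y\<close> of uncovered
  vertices other than \<open>v\<close>. If the feet are chosen as far along \<open>p\<close> as possible, then \<open>v\<close> and the
  segments cannot be linked to one another through \<open>Y\<close>, because a link would allow \<open>p\<close> to
  be rerouted through \<open>v\<close> at too small a loss. By modularity
  (\<open>independence_number_modular\<close>) the gains of the segments add up, and \<open>\<alpha> S\<close> becomes too
  large. The beginning of \<open>p\<close> counts as one more foot, which accounts for \<open>m + 1\<close> in place of \<open>m\<close>.

  Second, if \<open>\<alpha> S \<le> k + m - 1\<close>, then \<open>\<alpha> (S - p) \<le> k - 2\<close>. Start from \<open>p\<close>, a tree with at most two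
  leaves, and attach paths greedily until \<open>S\<close> is covered; each attached path costs one leaf and
  lowers the independence number of what remains uncovered (\<open>grown_tree_cover\<close>). The resulting tree
  has at most \<open>2 + (k - 2)\<close> leaves.
\<close>

section \<open>Paths as lists of vertices\<close>

text \<open>
  The empty list counts as a path. This lets segments, spokes and initial pieces of a path be
  empty, so that the rerouting arguments need no separate treatment of the ends.
\<close>
definition simple_path :: "'a pair_pre_digraph \<Rightarrow> 'a list \<Rightarrow> bool" where
  "simple_path G xs \<longleftrightarrow>
     set xs \<subseteq> pverts G \<and> distinct xs \<and> successively (\<lambda>x y. (x, y) \<in> parcs G) xs"

definition linked_via :: "'a pair_pre_digraph \<Rightarrow> 'a set \<Rightarrow> 'a set \<Rightarrow> 'a set \<Rightarrow> bool" where
  "linked_via G Y A B \<longleftrightarrow>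
     (\<exists>x\<in>A. \<exists>y\<in>B. \<exists>R. set R \<subseteq> Y \<and> simple_path G (x # R @ [y]))"

lemma simple_path_append:
  "simple_path G (xs @ ys) \<longleftrightarrow>
     simple_path G xs \<and> simple_path G ys \<and> set xs \<inter> set ys = {} \<and>
     (xs = [] \<or> ys = [] \<or> (last xs, hd ys) \<in> parcs G)"
  unfolding simple_path_def by (auto simp: successively_append_iff)

lemma simple_path_Cons:
  "simple_path G (x # xs) \<longleftrightarrow>
     x \<in> pverts G \<and> x \<notin> set xs \<and> simple_path G xs \<and> (xs = [] \<or> (x, hd xs) \<in> parcs G)"
  unfolding simple_path_def by (auto simp: successively_Cons)

lemma simple_path_Nil [simp]: "simple_path G []"
  by (simp add: simple_path_def)

lemma simple_path_take: "simple_path G xs \<Longrightarrow> simple_path G (take n xs)"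
  by (metis append_take_drop_id simple_path_append)

lemma simple_path_drop: "simple_path G xs \<Longrightarrow> simple_path G (drop n xs)"
  by (metis append_take_drop_id simple_path_append)

context pair_graph
begin

abbreviation \<alpha> :: "'a set \<Rightarrow> nat" where
  "\<alpha> \<equiv> independence_number G"

lemma simple_path_rev [simp]: "simple_path G (rev xs) \<longleftrightarrow> simple_path G xs"
  unfolding simple_path_def using arcs_symmetric by (auto elim!: successively_mono)

lemma linked_via_sym: "linked_via G Y A B \<Longrightarrow> linked_via G Y B A"
proof -
  assume "linked_via G Y A B"
  then obtain x y R where h: "x \<in> A" "y \<in> B" "set R \<subseteq> Y" "simple_path G (x # R @ [y])"
    unfolding linked_via_def by blast
  have "simple_path G (rev (x # R @ [y]))"
    using h(4) simple_path_rev by blast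
  then have "simple_path G (y # rev R @ [x])"
    by simp
  moreover have "set (rev R) \<subseteq> Y" using h(3) by simp
  ultimately show ?thesis
    using h unfolding linked_via_def by blast
qed

section \<open>The independence number\<close>

lemma finite_independent_cards: "finite {card X | X. X \<subseteq> S \<and> independent G X}"
proof -
  have "{card X | X. X \<subseteq> S \<and> independent G X} \<subseteq> card ` Pow (pverts G)"
    by (auto simp: independent_def)
  then show ?thesis
    using finite_subset pair_finite_verts by blast
qed

lemma maximum_independent_obtain:
  obtains I where "I \<subseteq> S" "independent G I" "card I = \<alpha> S"
proof -
  let ?C = "{card X | X. X \<subseteq> S \<and> independent G X}"
  have "card {} \<in> ?C" by (force simp: independent_def)
  then have "Max ?C \<in> ?C"
    by (intro Max_in finite_independent_cards) auto
  then show thesis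
    using that unfolding independence_number_def by auto
qed

lemma card_independent_le: "I \<subseteq> S \<Longrightarrow> independent G I \<Longrightarrow> card I \<le> \<alpha> S"
  unfolding independence_number_def
  by (intro Max_ge finite_independent_cards) auto

lemma independence_number_mono:
  assumes "S \<subseteq> S'"
  shows "\<alpha> S \<le> \<alpha> S'"
proof -
  obtain I where "I \<subseteq> S" "independent G I" "card I = \<alpha> S"
    by (rule maximum_independent_obtain)
  then show ?thesis
    using card_independent_le[of I S'] assms by auto
qed

lemma independent_subset: "independent G I \<Longrightarrow> J \<subseteq> I \<Longrightarrow> independent G J"
  unfolding independent_def by blast

lemma independent_finite: "independent G I \<Longrightarrow> finite I"
  unfolding independent_def using finite_subset pair_finite_verts by blast

lemma independence_number_empty [simp]: "\<alpha> {} = 0"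
  by (metis card.empty maximum_independent_obtain subset_empty)

lemma independence_number_Un_le: "\<alpha> (X \<union> Z) \<le> \<alpha> X + \<alpha> Z"
proof -
  obtain I where I: "I \<subseteq> X \<union> Z" "independent G I" "card I = \<alpha> (X \<union> Z)"
    by (rule maximum_independent_obtain)
  have "I = (I \<inter> X) \<union> (I \<inter> Z)" using I(1) by blast
  then have "card I \<le> card (I \<inter> X) + card (I \<inter> Z)"
    by (metis card_Un_le)
  moreover have "card (I \<inter> X) \<le> \<alpha> X" "card (I \<inter> Z) \<le> \<alpha> Z"
    using I(2) by (auto intro!: card_independent_le intro: independent_subset)
  ultimately show ?thesis using I(3) by linarith
qed

lemma independence_number_insert_le: "\<alpha> (insert v X) \<le> Suc (\<alpha> X)"
proof -
  obtain I where I: "I \<subseteq> insert v X" "independent G I" "card I = \<alpha> (insert v X)"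
    by (rule maximum_independent_obtain)
  have "card (I - {v}) \<le> \<alpha> X"
    using I by (intro card_independent_le) (auto intro: independent_subset)
  then show ?thesis
    using I(3) independent_finite[OF I(2)] by (metis Suc_le_mono card_Diff1_le card_Suc_Diff1
        Diff_empty Diff_insert0 le_SucI order_trans)
qed

lemma independence_number_Un_nonadjacent:
  assumes "X \<inter> Z = {}" and nonadj: "\<And>x z. x \<in> X \<Longrightarrow> z \<in> Z \<Longrightarrow> (x, z) \<notin> parcs G"
  shows "\<alpha> (X \<union> Z) = \<alpha> X + \<alpha> Z"
proof (rule antisym)
  obtain I where I: "I \<subseteq> X" "independent G I" "card I = \<alpha> X"
    by (rule maximum_independent_obtain)
  obtain J where J: "J \<subseteq> Z" "independent G J" "card J = \<alpha> Z"
    by (rule maximum_independent_obtain)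
  have "independent G (I \<union> J)"
    using I J nonadj arcs_symmetric unfolding independent_def by blast
  then have "card (I \<union> J) \<le> \<alpha> (X \<union> Z)"
    using I J by (intro card_independent_le) auto
  moreover have "card (I \<union> J) = card I + card J"
    using I J assms(1) by (intro card_Un_disjoint independent_finite) auto
  ultimately show "\<alpha> X + \<alpha> Z \<le> \<alpha> (X \<union> Z)"
    using I(3) J(3) by linarith
qed (rule independence_number_Un_le)

text \<open>
  Let \<open>N\<close> be the part of \<open>Y\<close> that can be reached from \<open>A\<close> inside \<open>Y\<close>. There is no edge between
  \<open>A \<union> N\<close> and \<open>(Y - N) \<union> B\<close>: such an edge would extend \<open>N\<close> or link \<open>A\<close> to \<open>B\<close>. Hence all four
  independence numbers split along \<open>N\<close>, and the same four summands occur on both sides. The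
  lemma is used in both directions: sets that leave \<open>\<alpha> Y\<close> unchanged one by one leave it
  unchanged together, and sets that raise it one by one raise it by the sum of their gains.
\<close>
lemma independence_number_modular:
  assumes disj: "A \<inter> Y = {}" "B \<inter> Y = {}" "A \<inter> B = {}"
    and sub: "A \<union> B \<union> Y \<subseteq> pverts G"
    and not_linked: "\<not> linked_via G Y A B"
  shows "\<alpha> (Y \<union> A \<union> B) + \<alpha> Y = \<alpha> (Y \<union> A) + \<alpha> (Y \<union> B)"
proof -
  define N where "N = {y \<in> Y. linked_via G Y A {y}}"
  have step: "z \<notin> Y \<and> z \<notin> B \<or> z \<in> N"
    if u: "u \<in> A \<union> N" and arc: "(u, z) \<in> parcs G" and zA: "z \<notin> A" for u z
  proof -
    have zV: "z \<in> pverts G" "u \<in> pverts G" "u \<noteq> z"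
      using arc in_arcsD1 in_arcsD2 no_loops' by blast+
    obtain x R where xR: "x \<in> A" "set R \<subseteq> Y" "simple_path G (x # R @ [z])"
    proof (cases "u \<in> A")
      case True
      then have "simple_path G (u # [] @ [z])"
        using arc zV by (auto simp: simple_path_Cons)
      then show thesis using that[of u "[]"] True by simp
    next
      case False
      then obtain x R where h: "x \<in> A" "set R \<subseteq> Y" "simple_path G (x # R @ [u])" "u \<in> Y"
        using u unfolding N_def linked_via_def by auto
      show thesis
      proof (cases "z \<in> set R")
        case True
        then obtain R1 R2 where R: "R = R1 @ z # R2"
          by (meson split_list)
        have "simple_path G ((x # R1 @ [z]) @ (R2 @ [u]))"
          using h(3) R by simp
        then have "simple_path G (x # R1 @ [z])"
          unfolding simple_path_append by blast
        then show thesis using that[of x R1] h R by auto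
      next
        case False
        have "simple_path G ((x # R @ [u]) @ [z])"
          unfolding simple_path_append
          using h(1,3) False arc zV zA by (auto simp: simple_path_Cons)
        then have "simple_path G (x # (R @ [u]) @ [z])" by simp
        then show thesis using that[of x "R @ [u]"] h by auto
      qed
    qed
    then have "linked_via G Y A {z}"
      unfolding linked_via_def by blast
    moreover have "z \<notin> B"
      using xR not_linked unfolding linked_via_def by blast
    ultimately show ?thesis
      unfolding N_def by blast
  qed
  have NY: "N \<subseteq> Y" unfolding N_def by blast
  have split: "\<alpha> (X \<union> Z) = \<alpha> X + \<alpha> Z"
    if "X \<subseteq> A \<union> N" "Z \<subseteq> (Y - N) \<union> B" for X Z
  proof (rule independence_number_Un_nonadjacent)
    show "X \<inter> Z = {}"
      using that disj NY by blast
    fix x z assume "x \<in> X" "z \<in> Z"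
    then show "(x, z) \<notin> parcs G"
      using step[of x z] that disj NY by blast
  qed
  have "Y \<union> A \<union> B = (A \<union> N) \<union> ((Y - N) \<union> B)" "Y = N \<union> (Y - N)"
    "Y \<union> A = (A \<union> N) \<union> (Y - N)" "Y \<union> B = N \<union> ((Y - N) \<union> B)"
    using NY by blast+
  then show ?thesis
    using split[of "A \<union> N" "(Y - N) \<union> B"] split[of N "Y - N"] split[of "A \<union> N" "Y - N"]
      split[of N "(Y - N) \<union> B"] by auto
qed

end

section \<open>Rerouting a path through a fan\<close>

text \<open>
  A fan joins \<open>v\<close> to the path \<open>p\<close>. The index \<open>a \<in> A\<close> stands for the spoke with inner vertices
  \<open>Q a\<close>, listed from \<open>v\<close> outwards, that ends in the vertex \<open>p ! (a - 1)\<close>, the last one of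
  \<open>take a p\<close>. Counting kept vertices instead of naming the foot of the spoke makes \<open>a = 0\<close>
  meaningful: nothing of \<open>p\<close> is kept, and the new path simply starts at the outer end of the
  spoke. This virtual spoke plays the part of a vertex in front of \<open>p\<close> that is adjacent
  to everything.
\<close>
definition fan :: "'a pair_pre_digraph \<Rightarrow> 'a list \<Rightarrow> 'a \<Rightarrow> nat set \<Rightarrow> (nat \<Rightarrow> 'a list) \<Rightarrow> bool" where
  "fan G p v A Q \<longleftrightarrow> A \<subseteq> {..length p} \<and>
     (\<forall>a\<in>A. simple_path G (take a p @ rev (Q a) @ [v]) \<and> set (Q a) \<inter> set p = {}) \<and>
     (\<forall>a\<in>A. \<forall>b\<in>A. a \<noteq> b \<longrightarrow> set (Q a) \<inter> set (Q b) = {})"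

lemma set_take_nth: "set (take a p) = {p ! l | l. l < a \<and> l < length p}"
proof (intro set_eqI iffI)
  fix x assume "x \<in> {p ! l | l. l < a \<and> l < length p}"
  then obtain l where "l < a" "l < length p" "x = p ! l" by blast
  then show "x \<in> set (take a p)"
    by (auto simp: in_set_conv_nth intro!: exI[of _ l])
qed (auto simp: in_set_conv_nth)

lemma set_drop_nth: "set (drop j p) = {p ! l | l. j \<le> l \<and> l < length p}"
proof (intro set_eqI iffI)
  fix x assume "x \<in> set (drop j p)"
  then obtain l where "l < length p - j" "x = p ! (j + l)"
    by (auto simp: in_set_conv_nth)
  then show "x \<in> {p ! l | l. j \<le> l \<and> l < length p}"
    by (auto intro!: exI[of _ "j + l"])
next
  fix x assume "x \<in> {p ! l | l. j \<le> l \<and> l < length p}"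
  then obtain l where "j \<le> l" "l < length p" "x = p ! l" by blast
  then show "x \<in> set (drop j p)"
    by (auto simp: in_set_conv_nth intro!: exI[of _ "l - j"])
qed

lemma set_drop_take_nth: "set (drop i (take b p)) = {p ! l | l. i \<le> l \<and> l < b \<and> l < length p}"
  unfolding set_drop_nth by force

text \<open>
  This turns a path from \<open>v\<close> that meets \<open>p\<close> only in its last vertex into a spoke.
\<close>
lemma (in pair_graph) simple_path_take_spoke:
  assumes p: "simple_path G p" "j < length p"
    and L: "simple_path G (v # L @ [p ! j])" "set L \<inter> set p = {}" "v \<notin> set p"
  shows "simple_path G (take (Suc j) p @ rev L @ [v])"
proof -
  have "simple_path G (rev (v # L @ [p ! j]))"
    using L(1) simple_path_rev by blast
  then have "simple_path G (p ! j # rev L @ [v])"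
    by simp
  moreover have "simple_path G (take j p @ [p ! j])"
    using simple_path_take[OF p(1)] take_Suc_conv_app_nth[OF p(2)] by metis
  moreover have "set (take j p) \<inter> set (rev L @ [v]) = {}"
    using L(2,3) set_take_subset[of j p] by auto
  ultimately have "simple_path G (take j p @ (p ! j # rev L @ [v]))"
    unfolding simple_path_append by auto
  then show ?thesis
    using take_Suc_conv_app_nth[OF p(2)] by simp
qed

text \<open>
  The situation to be excluded in the proof of the path theorem below: every path leaves more
  than \<open>t\<close> independent vertices of \<open>S\<close> uncovered, yet \<open>p\<close> would leave only \<open>t\<close> if it did not miss
  the single vertex \<open>v\<close>. Among all fans with the same number of spokes, the one chosen has
  its feet as far towards the end of \<open>p\<close> as possible.
\<close>
locale saturated_fan = pair_graph G for G :: "'a pair_pre_digraph" +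
  fixes S :: "'a set" and t :: nat and p :: "'a list" and v :: 'a
    and A :: "nat set" and Q :: "nat \<Rightarrow> 'a list"
  assumes S_verts: "S \<subseteq> pverts G"
    and t_less: "\<And>xs. simple_path G xs \<Longrightarrow> t < \<alpha> (S - set xs)"
    and p_path: "simple_path G p"
    and v_S: "v \<in> S"
    and v_p: "v \<notin> set p"
    and t_ge: "\<alpha> (S - set p - {v}) \<le> t"
    and fan: "fan G p v A Q"
    and fan_max: "\<And>A' Q'. fan G p v A' Q' \<Longrightarrow> card A' = card A \<Longrightarrow> \<Sum>A' \<le> \<Sum>A"
begin

definition Y :: "'a set" where "Y = S - set p - {v}"

definition seg :: "nat \<Rightarrow> nat \<Rightarrow> 'a set" where
  "seg a j = {p ! l | l. a \<le> l \<and> l < j \<and> l < length p} \<inter> S"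

text \<open>
  Behind the foot of each spoke \<open>a\<close>, the segment \<open>W a\<close> is the shortest one whose vertices, when
  left out by a path, cost an additional independent vertex over \<open>Y\<close>. A path may therefore
  skip the proper initial parts of these segments free of charge.
\<close>
definition e :: "nat \<Rightarrow> nat" where
  "e a = (LEAST j. t < \<alpha> (Y \<union> seg a j))"

definition W :: "nat \<Rightarrow> 'a set" where "W a = seg a (e a)"

definition F :: "'a set" where "F = insert v (\<Union>b\<in>A. set (Q b))"

lemma p_distinct: "distinct p"
  using p_path by (simp add: simple_path_def)

lemma p_nth_eq: "l < length p \<Longrightarrow> l' < length p \<Longrightarrow> p ! l = p ! l' \<longleftrightarrow> l = l'"
  using p_distinct nth_eq_iff_index_eq by blast

lemma finite_A: "finite A"
  using fan unfolding fan_def using finite_subset by blast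

lemma A_le: "a \<in> A \<Longrightarrow> a \<le> length p"
  using fan unfolding fan_def by blast

lemma fan_path: "a \<in> A \<Longrightarrow> simple_path G (take a p @ rev (Q a) @ [v])"
  using fan unfolding fan_def by blast

lemma Q_p: "a \<in> A \<Longrightarrow> set (Q a) \<inter> set p = {}"
  using fan unfolding fan_def by blast

lemma Q_disjoint: "a \<in> A \<Longrightarrow> b \<in> A \<Longrightarrow> a \<noteq> b \<Longrightarrow> set (Q a) \<inter> set (Q b) = {}"
  using fan unfolding fan_def by blast

lemma fan_path_rev:
  assumes "a \<in> A" shows "simple_path G (v # Q a @ rev (take a p))"
proof -
  have "simple_path G (rev (take a p @ rev (Q a) @ [v]))"
    using fan_path[OF assms] simple_path_rev by blast
  then show ?thesis by simp
qed

lemma F_p: "F \<inter> set p = {}"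
  using Q_p v_p unfolding F_def by blast

lemma alpha_Y: "\<alpha> Y = t"
proof -
  have "t < \<alpha> (S - set p)" using t_less p_path by blast
  also have "S - set p = insert v Y" using v_S v_p unfolding Y_def by blast
  finally have "t < \<alpha> (insert v Y)" .
  then show ?thesis
    using independence_number_insert_le[of v Y] t_ge unfolding Y_def by linarith
qed

text \<open>
  The way every rerouting below is used: a path whose uncovered part of \<open>S\<close> lies in \<open>X\<close> forces
  \<open>\<alpha> X\<close> above \<open>t\<close>.
\<close>
lemma path_missing:
  assumes "simple_path G xs" "S - set xs \<subseteq> X"
  shows "t < \<alpha> X"
  using t_less[OF assms(1)] independence_number_mono[OF assms(2)] by linarith

text \<open>
  Follow \<open>p\<close> to the foot of spoke \<open>a\<close>, take the spoke to \<open>v\<close>, return to \<open>p\<close> along \<open>L\<close> and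
  continue to the end: this path covers \<open>v\<close> and skips only the segment between the two contacts.
\<close>
lemma detour:
  assumes a: "a \<in> A" "a \<le> j" "j < length p"
    and L: "simple_path G (v # L @ [p ! j])" "set L \<inter> set p = {}" "set L \<inter> set (Q a) = {}"
  shows "t < \<alpha> (Y \<union> seg a j)"
proof (rule path_missing)
  let ?xs = "(take a p @ rev (Q a) @ [v]) @ (L @ drop j p)"
  have hd: "drop j p \<noteq> []" "hd (drop j p) = p ! j"
    using a(3) by (auto simp: hd_drop_conv_nth)
  have vL: "simple_path G (v # L)" "(last (v # L), p ! j) \<in> parcs G"
    using L(1) simple_path_append[of G "v # L" "[p ! j]"] by auto
  have snd: "simple_path G (L @ drop j p)"
    unfolding simple_path_append
    using vL simple_path_drop[OF p_path] L(2) hd set_drop_subset[of j p]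
    by (auto simp: simple_path_Cons)
  have "set (take a p) \<inter> set (drop j p) = {}"
    using p_distinct a(2) set_take_disj_set_drop_if_distinct by blast
  then have disj: "set (take a p @ rev (Q a) @ [v]) \<inter> set (L @ drop j p) = {}"
    using L Q_p[OF a(1)] vL v_p set_take_subset[of a p] set_drop_subset[of j p]
    by (auto simp: simple_path_Cons)
  have "(v, hd (L @ drop j p)) \<in> parcs G"
    using vL hd by (cases L) (auto simp: simple_path_Cons)
  then show "simple_path G ?xs"
    using fan_path[OF a(1)] snd disj by (subst simple_path_append) auto
  show "S - set ?xs \<subseteq> Y \<union> seg a j"
  proof
    fix x assume x: "x \<in> S - set ?xs"
    show "x \<in> Y \<union> seg a j"
    proof (cases "x \<in> set p")
      case True
      then obtain l where l: "l < length p" "x = p ! l" by (auto simp: in_set_conv_nth)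
      then have "a \<le> l" "l < j"
        using x by (auto simp: set_take_nth set_drop_nth not_le not_less)
      then show ?thesis using l x unfolding seg_def by blast
    next
      case False
      then show ?thesis using x unfolding Y_def by auto
    qed
  qed
qed

lemma tail_exceeds:
  assumes a: "a \<in> A"
  shows "t < \<alpha> (Y \<union> seg a (length p))"
proof (rule path_missing)
  show "simple_path G (take a p @ rev (Q a) @ [v])" by (rule fan_path[OF a])
  show "S - set (take a p @ rev (Q a) @ [v]) \<subseteq> Y \<union> seg a (length p)"
  proof
    fix x assume x: "x \<in> S - set (take a p @ rev (Q a) @ [v])"
    show "x \<in> Y \<union> seg a (length p)"
    proof (cases "x \<in> set p")
      case True
      then obtain l where l: "l < length p" "x = p ! l" by (auto simp: in_set_conv_nth)
      then have "a \<le> l"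
        using x by (auto simp: set_take_nth not_less)
      then show ?thesis using l x unfolding seg_def by blast
    next
      case False
      then show ?thesis using x unfolding Y_def by auto
    qed
  qed
qed

lemma e_le: "t < \<alpha> (Y \<union> seg a j) \<Longrightarrow> e a \<le> j"
  unfolding e_def by (rule Least_le)

lemma below_e: "j < e a \<Longrightarrow> \<alpha> (Y \<union> seg a j) \<le> t"
  unfolding e_def using not_less_Least by (metis not_less)

lemma alpha_W: "a \<in> A \<Longrightarrow> t < \<alpha> (Y \<union> W a)"
  unfolding W_def e_def using LeastI[of "\<lambda>j. t < \<alpha> (Y \<union> seg a j)", OF tail_exceeds] .

text \<open>
  Returning along spoke \<open>b\<close> skips only what lies between the feet of \<open>a\<close> and \<open>b\<close>, so \<open>W a\<close> ends
  before the foot of the next spoke. In particular the segments \<open>W a\<close> are disjoint.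
\<close>
lemma e_less:
  assumes "a \<in> A" "b \<in> A" "a < b"
  shows "e a < b"
proof -
  have b: "b - 1 < length p" "Suc (b - 1) = b" using assms A_le[of b] by auto
  have "take b p = take (b - 1) p @ [p ! (b - 1)]"
    using take_Suc_conv_app_nth[OF b(1)] b(2) by simp
  then have "simple_path G ((v # Q b @ [p ! (b - 1)]) @ rev (take (b - 1) p))"
    using fan_path_rev[OF assms(2)] by simp
  then have "simple_path G (v # Q b @ [p ! (b - 1)])"
    unfolding simple_path_append by blast
  then have "t < \<alpha> (Y \<union> seg a (b - 1))"
    using assms b Q_p Q_disjoint[of b a] by (intro detour[of a "b - 1" "Q b"]) auto
  then show ?thesis using e_le b by fastforce
qed

lemma seg_mem:
  assumes "x \<in> seg a j"
  obtains l where "a \<le> l" "l < j" "l < length p" "x = p ! l" "x \<in> S"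
  using assms unfolding seg_def by blast

text \<open>
  Consider a link from the fan to a vertex \<open>p ! j\<close> of \<open>W a\<close> and the last fan vertex on it. If
  this is \<open>v\<close> or lies on a spoke other than \<open>a\<close>, then going out on that spoke gives a detour that
  skips too little. If it lies on spoke \<open>a\<close> itself, redirecting this spoke along the link moves
  its foot forward to \<open>p ! j\<close>, against the extremal choice of the fan.
\<close>
lemma W_not_linked_fan:
  assumes a: "a \<in> A"
  shows "\<not> linked_via G Y F (W a)"
proof
  assume "linked_via G Y F (W a)"
  then obtain y0 x R0 where h: "y0 \<in> F" "x \<in> W a" "set R0 \<subseteq> Y" "simple_path G (y0 # R0 @ [x])"
    unfolding linked_via_def by blast
  obtain R1 y R where split: "y0 # R0 = R1 @ y # R" "y \<in> F" "\<forall>z\<in>set R. z \<notin> F"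
    using split_list_last_prop[of "y0 # R0" "\<lambda>z. z \<in> F"] h(1) by auto
  have "simple_path G (R1 @ (y # R @ [x]))"
    using h(4) split(1) by (metis append_Cons append_assoc)
  then have path: "simple_path G (y # R @ [x])"
    unfolding simple_path_append by blast
  have RY: "set R \<subseteq> Y"
    using h(3) split(1) by (cases R1) auto
  obtain j where j: "a \<le> j" "j < e a" "j < length p" "x = p ! j"
    using h(2) seg_mem unfolding W_def by metis
  have no_detour: False
    if "simple_path G (v # L @ [p ! j])" "set L \<inter> set p = {}" "set L \<inter> set (Q a) = {}" for L
    using detour[OF a j(1,3) that] below_e[OF j(2)] by linarith
  show False
  proof (cases "y = v")
    case True
    have "set R \<inter> set (Q a) = {}"
      using split(3) a unfolding F_def by blast
    then show False
      using no_detour[of R] path True j RY unfolding Y_def by blast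
  next
    case False
    then obtain b where b: "b \<in> A" "y \<in> set (Q b)"
      using split(2) unfolding F_def by blast
    then obtain Q1 Q2 where Qb: "Q b = Q1 @ y # Q2"
      by (meson split_list)
    let ?L = "Q1 @ y # R"
    have "simple_path G ((v # Q1 @ [y]) @ (Q2 @ rev (take b p)))"
      using fan_path_rev[OF b(1)] Qb by simp
    then have pre: "simple_path G (v # Q1 @ [y])"
      unfolding simple_path_append by blast
    have Rx: "simple_path G (R @ [x])" "(y, hd (R @ [x])) \<in> parcs G"
      using path by (auto simp: simple_path_Cons)
    have vQ1F: "set (v # Q1 @ [y]) \<subseteq> F"
    proof -
      have "set (Q1 @ [y]) \<subseteq> set (Q b)" using Qb by auto
      then show ?thesis using b(1) unfolding F_def by auto
    qed
    have xF: "x \<notin> F"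
      using F_p j by auto
    have "simple_path G ((v # Q1 @ [y]) @ (R @ [x]))"
      by (subst simple_path_append) (use pre Rx vQ1F xF split(3) in auto)
    then have L: "simple_path G (v # ?L @ [p ! j])"
      using j by simp
    have Lp: "set ?L \<inter> set p = {}"
      using vQ1F F_p RY unfolding Y_def by auto
    have L_Q: "set ?L \<inter> set (Q c) = {}" if "c \<in> A" "c \<noteq> b" for c
      using Q_disjoint[OF b(1) that(1)] that Qb split(3) unfolding F_def by auto
    show False
    proof (cases "b = a")
      case False
      then show False using no_detour[OF L Lp] L_Q a by blast
    next
      case True
      \<comment> \<open>A spoke with foot \<open>p ! j\<close> has index \<open>Suc j\<close>, the number of vertices kept.\<close>
      let ?A = "insert (Suc j) (A - {a})" and ?Q = "Q(Suc j := ?L)"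
      have fresh: "Suc j \<notin> A"
        using e_less[OF a, of "Suc j"] j by auto
      have new: "simple_path G (take (Suc j) p @ rev ?L @ [v])"
        by (rule simple_path_take_spoke[OF p_path j(3) L Lp v_p])
      have "fan G p v ?A ?Q"
        unfolding fan_def
      proof (intro conjI ballI impI)
        show "?A \<subseteq> {..length p}" using A_le j by auto
      next
        fix c assume c: "c \<in> ?A"
        show "simple_path G (take c p @ rev (?Q c) @ [v])"
          using c new fan_path fresh by (cases "c = Suc j") auto
        show "set (?Q c) \<inter> set p = {}"
          using c Lp Q_p fresh by (cases "c = Suc j") auto
      next
        fix c d assume "c \<in> ?A" "d \<in> ?A" "c \<noteq> d"
        then show "set (?Q c) \<inter> set (?Q d) = {}"
          using L_Q True Q_disjoint fresh
          by (cases "c = Suc j"; cases "d = Suc j") (auto simp del: set_append)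
      qed
      moreover have "card ?A = card A"
        using fresh finite_A card_Suc_Diff1[OF finite_A a] by simp
      ultimately have "\<Sum>?A \<le> \<Sum>A" by (rule fan_max)
      moreover have "\<Sum>?A = Suc j + \<Sum>(A - {a})"
        using fresh finite_A by simp
      moreover have "\<Sum>A = a + \<Sum>(A - {a})"
        using a finite_A by (simp add: sum.remove)
      ultimately show False using j by linarith
    qed
  qed
qed

lemma seg_disjoint_Y: "seg a j \<inter> Y = {}"
  unfolding seg_def Y_def by auto

lemma seg_sub: "seg a j \<subseteq> S"
  unfolding seg_def by blast

lemma Y_sub: "Y \<subseteq> S"
  unfolding Y_def by blast

lemma seg_disjoint: "i \<le> b \<Longrightarrow> seg a i \<inter> seg b j = {}"
  unfolding seg_def using p_nth_eq by fastforce

text \<open>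
  The exchange known from the Chvatal-Erdos theorem: follow \<open>p\<close> to the foot of \<open>a\<close>, cross via \<open>v\<close>
  to the foot of \<open>b\<close>, run backwards to \<open>p ! i\<close>, cross along \<open>R\<close> to \<open>p ! j\<close> and continue to the end.
  The path is simple because \<open>R\<close> avoids the fan: a vertex of both would link the fan to \<open>W b\<close>.
\<close>
lemma crossing:
  assumes ab: "a \<in> A" "b \<in> A" "a < b"
    and i: "a \<le> i" "i < e a" "p ! i \<in> S" and j: "b \<le> j" "j < e b" "p ! j \<in> S" "j < length p"
    and R: "set R \<subseteq> Y" "simple_path G (p ! i # R @ [p ! j])"
  shows "t < \<alpha> (Y \<union> seg a i \<union> seg b j)"
proof (rule path_missing)
  have ib: "i < b" using e_less[OF ab] i by linarith
  have bl: "b \<le> length p" using A_le ab by blast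
  have RF: "set R \<inter> F = {}"
  proof (rule ccontr)
    assume "set R \<inter> F \<noteq> {}"
    then obtain r R1 R2 where r: "r \<in> F" "R = R1 @ r # R2"
      by (metis disjoint_iff split_list)
    have "simple_path G ((p ! i # R1) @ (r # R2 @ [p ! j]))"
      using R(2) r(2) by simp
    then have "simple_path G (r # R2 @ [p ! j])"
      unfolding simple_path_append by blast
    moreover have "p ! j \<in> W b"
      unfolding W_def seg_def using j by blast
    ultimately have "linked_via G Y F (W b)"
      using r R(1) unfolding linked_via_def by force
    then show False using W_not_linked_fan ab by blast
  qed
  let ?M = "drop i (take b p)"
  let ?xs = "(take a p @ rev (Q a) @ [v]) @ (Q b @ rev ?M) @ (R @ drop j p)"
  have M: "?M \<noteq> []" "hd ?M = p ! i" "last (rev ?M) = p ! i"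
    using ib bl by (auto simp: hd_drop_conv_nth last_rev)
  have "simple_path G (v # Q b @ rev (take i (take b p) @ ?M))"
    using fan_path_rev[OF ab(2)] by (simp only: append_take_drop_id)
  then have "simple_path G ((v # Q b @ rev ?M) @ rev (take i (take b p)))"
    by (simp only: rev_append append_assoc append_Cons)
  then have mid: "simple_path G ([v] @ (Q b @ rev ?M))"
    using simple_path_append[of G "v # Q b @ rev ?M" "rev (take i (take b p))"] by simp
  have dj: "drop j p \<noteq> []" "hd (drop j p) = p ! j"
    using j(4) by (auto simp: hd_drop_conv_nth)
  have R': "simple_path G R" "R = [] \<or> (last R, p ! j) \<in> parcs G"
      "(p ! i, hd (R @ [p ! j])) \<in> parcs G"
    using R(2) by (auto simp: simple_path_Cons simple_path_append)
  have Rp: "set R \<inter> set p = {}" "v \<notin> set R"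
    using R(1) unfolding Y_def by auto
  have Q_F: "set (Q a) \<subseteq> F" "set (Q b) \<subseteq> F"
    using ab unfolding F_def by auto
  have sets: "set (take a p) \<subseteq> set p" "set ?M \<subseteq> set p" "set (drop j p) \<subseteq> set p"
    by (auto dest: in_set_takeD in_set_dropD)
  have disj: "set (take a p) \<inter> set ?M = {}" "set (take a p) \<inter> set (drop j p) = {}"
    "set ?M \<inter> set (drop j p) = {}"
    unfolding set_take_nth set_drop_nth set_drop_take_nth using ab i j p_nth_eq by fastforce+
  have last: "simple_path G (R @ drop j p)"
    unfolding simple_path_append
    using R' Rp simple_path_drop[OF p_path] dj sets by auto
  have "(p ! i, hd (R @ drop j p)) \<in> parcs G"
    using R'(3) dj by (cases R) auto
  then have mid_last: "simple_path G ((Q b @ rev ?M) @ (R @ drop j p))"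
    using mid last M disj sets Rp Q_F RF F_p dj
    by (subst simple_path_append) (auto simp: simple_path_Cons)
  have "(v, hd ((Q b @ rev ?M) @ (R @ drop j p))) \<in> parcs G"
  proof -
    have "(v, hd (Q b @ rev ?M)) \<in> parcs G"
      using mid M by (simp add: simple_path_Cons)
    then show ?thesis using M by (simp add: hd_append split: if_splits)
  qed
  moreover have "set (take a p @ rev (Q a) @ [v]) \<inter> set ((Q b @ rev ?M) @ (R @ drop j p)) = {}"
  proof -
    have "set (Q a) \<inter> set (Q b) = {}" using Q_disjoint ab by blast
    moreover have "v \<notin> set (Q b)" using mid by (simp add: simple_path_Cons)
    ultimately show ?thesis
      unfolding set_append set_rev list.set
      using disj sets Rp Q_F RF F_p v_p by blast
  qed
  ultimately show "simple_path G ?xs"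
    using fan_path[OF ab(1)] mid_last by (subst simple_path_append) auto
  show "S - set ?xs \<subseteq> Y \<union> seg a i \<union> seg b j"
  proof
    fix x assume x: "x \<in> S - set ?xs"
    show "x \<in> Y \<union> seg a i \<union> seg b j"
    proof (cases "x \<in> set p")
      case True
      then obtain l where l: "l < length p" "x = p ! l" by (auto simp: in_set_conv_nth)
      moreover have "x \<notin> set (take a p)" "x \<notin> set ?M" "x \<notin> set (drop j p)"
        using x by auto
      ultimately have "a \<le> l \<and> (l < i \<or> b \<le> l) \<and> l < j"
        unfolding set_take_nth set_drop_nth set_drop_take_nth by force
      then show ?thesis using l x unfolding seg_def by blast
    next
      case False
      then show ?thesis using x unfolding Y_def by auto
    qed
  qed
qed

text \<open>
  Take a link between \<open>W a\<close> and \<open>W b\<close> whose ends lie as early as possible. Then the parts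
  skipped by the crossing path are not linked to each other. Each of them is free of charge, so
  by modularity both together are, which contradicts the previous lemma.
\<close>
lemma W_not_linked:
  assumes ab: "a \<in> A" "b \<in> A" "a < b"
  shows "\<not> linked_via G Y (W a) (W b)"
proof
  define P where "P = (\<lambda>(i, j). a \<le> i \<and> i < e a \<and> p ! i \<in> S \<and> b \<le> j \<and> j < e b \<and> p ! j \<in> S \<and>
    j < length p \<and> linked_via G Y {p ! i} {p ! j})"
  assume "linked_via G Y (W a) (W b)"
  then obtain x y where xy: "x \<in> W a" "y \<in> W b" "linked_via G Y {x} {y}"
    unfolding linked_via_def by blast
  obtain i j where "P (i, j)"
    using xy unfolding W_def P_def by (elim seg_mem) auto
  then obtain ij where ij: "P ij" "\<And>ij'. P ij' \<Longrightarrow> fst ij + snd ij \<le> fst ij' + snd ij'"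
    using ex_has_least_nat[of P "(i, j)" "\<lambda>ij. fst ij + snd ij"] by blast
  obtain i j where [simp]: "ij = (i, j)" by (cases ij)
  have P: "a \<le> i" "i < e a" "p ! i \<in> S" "b \<le> j" "j < e b" "p ! j \<in> S" "j < length p"
    "linked_via G Y {p ! i} {p ! j}"
    using ij(1) unfolding P_def by auto
  have ib: "i < b" using e_less[OF ab] P by linarith
  have "\<not> linked_via G Y (seg a i) (seg b j)"
  proof
    assume "linked_via G Y (seg a i) (seg b j)"
    then obtain x y where xy: "x \<in> seg a i" "y \<in> seg b j" "linked_via G Y {x} {y}"
      unfolding linked_via_def by blast
    obtain i' where i': "a \<le> i'" "i' < i" "x = p ! i'" "x \<in> S" using xy(1) by (rule seg_mem)
    obtain j' where j': "b \<le> j'" "j' < j" "y = p ! j'" "y \<in> S" using xy(2) by (rule seg_mem)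
    have "P (i', j')" using P i' j' xy(3) unfolding P_def by auto
    then show False using ij(2) i' j' by fastforce
  qed
  then have "\<alpha> (Y \<union> seg a i \<union> seg b j) + \<alpha> Y = \<alpha> (Y \<union> seg a i) + \<alpha> (Y \<union> seg b j)"
    using seg_disjoint_Y seg_disjoint[of i b a j] ib seg_sub Y_sub S_verts
    by (intro independence_number_modular) (auto, blast+)
  then have "\<alpha> (Y \<union> seg a i \<union> seg b j) \<le> t"
    using alpha_Y below_e[OF P(2)] below_e[OF P(5)] by linarith
  moreover obtain R where "set R \<subseteq> Y" "simple_path G (p ! i # R @ [p ! j])"
    using P(8) unfolding linked_via_def by blast
  ultimately show False
    using crossing[OF ab P(1-7)] by fastforce
qed

lemma W_disjoint:
  assumes "a \<in> A" "b \<in> A" "a \<noteq> b"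
  shows "W a \<inter> W b = {}"
proof -
  consider "a < b" | "b < a" using assms(3) by linarith
  then show ?thesis
  proof cases
    case 1
    then show ?thesis using e_less[OF assms(1,2)] seg_disjoint unfolding W_def by simp
  next
    case 2
    then show ?thesis using e_less[OF assms(2,1)] seg_disjoint[of "e b" a b "e a"]
      unfolding W_def by auto
  qed
qed

text \<open>
  The vertex \<open>v\<close> and the segments \<open>W a\<close> are pairwise unlinked through \<open>Y\<close>, and each raises the
  independence number of \<open>Y\<close>, so by modularity the gains add up.
\<close>
lemma independence_number_ge: "t + 1 + card A \<le> \<alpha> S"
proof -
  have "t + 1 + card B \<le> \<alpha> (Y \<union> insert v (\<Union>b\<in>B. W b))" if "B \<subseteq> A" for B
    using finite_subset[OF that finite_A] that
  proof (induction B rule: finite_induct)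
    case empty
    have "S - set p = Y \<union> insert v {}" using v_S v_p unfolding Y_def by auto
    then show ?case using t_less[OF p_path] by simp
  next
    case (insert a B)
    let ?U = "insert v (\<Union>b\<in>B. W b)"
    have "\<not> linked_via G Y ?U (W a)"
    proof
      assume "linked_via G Y ?U (W a)"
      then consider "linked_via G Y F (W a)" | b where "b \<in> B" "linked_via G Y (W b) (W a)"
        unfolding linked_via_def F_def by blast
      then show False
      proof cases
        case 1
        then show False using W_not_linked_fan insert.prems by blast
      next
        case 2
        then show False
          using W_not_linked[of a b] W_not_linked[of b a] linked_via_sym insert.prems insert.hyps
          by (metis insert_subset linorder_neqE_nat subsetD)
      qed
    qed
    moreover have "?U \<inter> W a = {}"
    proof -
      have "v \<notin> W a" using v_p unfolding W_def seg_def by auto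
      then show ?thesis using W_disjoint insert.prems insert.hyps by blast
    qed
    moreover have "?U \<inter> Y = {}" "W a \<inter> Y = {}"
      using seg_disjoint_Y unfolding W_def Y_def by blast+
    moreover have "?U \<union> W a \<union> Y \<subseteq> pverts G"
      using S_verts v_S seg_sub Y_sub unfolding W_def by blast
    ultimately have "\<alpha> (Y \<union> ?U \<union> W a) + \<alpha> Y = \<alpha> (Y \<union> ?U) + \<alpha> (Y \<union> W a)"
      by (intro independence_number_modular) auto
    moreover have "Y \<union> insert v (\<Union>b\<in>insert a B. W b) = Y \<union> ?U \<union> W a" by blast
    ultimately show ?case
      using insert alpha_Y alpha_W[of a] by simp
  qed
  from this[of A] have "t + 1 + card A \<le> \<alpha> (Y \<union> insert v (\<Union>b\<in>A. W b))" by simp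
  also have "\<dots> \<le> \<alpha> S"
    using v_S seg_sub Y_sub unfolding W_def by (intro independence_number_mono) blast
  finally show ?thesis .
qed

end

section \<open>A path that lowers the independence number\<close>

definition disjointly_joined :: "'a pair_pre_digraph \<Rightarrow> nat \<Rightarrow> 'a \<Rightarrow> 'a \<Rightarrow> bool" where
  "disjointly_joined G m x y \<longleftrightarrow>
     (\<exists>P. finite P \<and> m \<le> card P \<and> (\<forall>I\<in>P. simple_path G (x # I @ [y])) \<and>
        (\<forall>I\<in>P. \<forall>J\<in>P. I \<noteq> J \<longrightarrow> set I \<inter> set J = {}))"

context pair_graph
begin

text \<open>
  Cut each of the \<open>m\<close> paths from \<open>v\<close> to \<open>hd p\<close> at its first vertex on \<open>p\<close>. None of them reaches
  \<open>p\<close> first at \<open>hd p\<close>, so all feet are inner vertices of disjoint paths and therefore distinct, without any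
  appeal to the fan version of Menger's theorem. The virtual spoke \<open>0\<close> is the additional one.
\<close>
lemma fan_exists:
  assumes p: "simple_path G p" "p \<noteq> []" and v: "v \<in> pverts G" "v \<notin> set p"
    and joined: "disjointly_joined G m v (hd p)"
    and no_spoke: "\<And>L. simple_path G (v # L @ [hd p]) \<Longrightarrow> set L \<inter> set p = {} \<Longrightarrow> False"
  shows "\<exists>A Q. fan G p v A Q \<and> card A = Suc m"
proof -
  obtain P where P: "finite P" "m \<le> card P" "\<And>I. I \<in> P \<Longrightarrow> simple_path G (v # I @ [hd p])"
    "\<And>I J. I \<in> P \<Longrightarrow> J \<in> P \<Longrightarrow> I \<noteq> J \<Longrightarrow> set I \<inter> set J = {}"
    using joined unfolding disjointly_joined_def by blast
  have "\<exists>L k. k < length p \<and> p ! k \<in> set I \<and> set L \<subseteq> set I \<and> set L \<inter> set p = {} \<and>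
      simple_path G (v # L @ [p ! k])" if I: "I \<in> P" for I
  proof -
    have "\<exists>x\<in>set (I @ [hd p]). x \<in> set p" using p by simp
    then obtain L u L' where split: "I @ [hd p] = L @ u # L'" "u \<in> set p" "\<forall>z\<in>set L. z \<notin> set p"
      using split_list_first_prop[of "I @ [hd p]" "\<lambda>x. x \<in> set p"] by blast
    have "simple_path G ((v # L @ [u]) @ L')"
      using P(3)[OF I] split(1) by simp
    then have path: "simple_path G (v # L @ [u])"
      unfolding simple_path_append by blast
    then have "u \<noteq> hd p"
      using no_spoke split(3) by blast
    then have "L' \<noteq> []" using split(1) by auto
    then have "I = L @ u # butlast L'"
      using split(1) by (metis append_butlast_last_id append_is_Nil_conv butlast_append butlast_snoc
          list.distinct(1) butlast.simps(2))
    then have "u \<in> set I" "set L \<subseteq> set I" by auto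
    moreover obtain k where "k < length p" "u = p ! k"
      using split(2) by (auto simp: in_set_conv_nth)
    ultimately show ?thesis
      using path split(3) by blast
  qed
  then obtain f g where fg: "\<And>I. I \<in> P \<Longrightarrow> g I < length p \<and> p ! g I \<in> set I \<and> set (f I) \<subseteq> set I \<and>
      set (f I) \<inter> set p = {} \<and> simple_path G (v # f I @ [p ! g I])"
    by metis
  have inj: "inj_on (\<lambda>I. Suc (g I)) P"
    using fg P(4) by (intro inj_onI) (metis Suc_inject disjoint_iff)
  obtain B where B: "B \<subseteq> (\<lambda>I. Suc (g I)) ` P" "card B = m"
    using obtain_subset_with_card_n[of m "(\<lambda>I. Suc (g I)) ` P"] card_image[OF inj] P(2) by metis
  define Q where "Q a = (if a = 0 then [] else f (the_inv_into P (\<lambda>I. Suc (g I)) a))" for a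
  have Q: "Q (Suc (g I)) = f I" if "I \<in> P" for I
    using the_inv_into_f_f[OF inj that] unfolding Q_def by simp
  have [simp]: "Q 0 = []" unfolding Q_def by simp
  have "fan G p v (insert 0 B) Q"
    unfolding fan_def
  proof (intro conjI ballI impI)
    show "insert 0 B \<subseteq> {..length p}" using B(1) fg by (auto simp: Suc_le_eq)
  next
    fix a assume "a \<in> insert 0 B"
    then consider "a = 0" | I where "I \<in> P" "a = Suc (g I)" using B(1) by blast
    then have "simple_path G (take a p @ rev (Q a) @ [v]) \<and> set (Q a) \<inter> set p = {}"
    proof cases
      case 1
      then show ?thesis using v by (simp add: simple_path_Cons)
    next
      case 2
      then show ?thesis
        using simple_path_take_spoke[of p "g I" v "f I"] fg[of I] Q p v by simp
    qed
    then show "simple_path G (take a p @ rev (Q a) @ [v])" "set (Q a) \<inter> set p = {}" by blast+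
  next
    fix a b assume ab: "a \<in> insert 0 B" "b \<in> insert 0 B" "a \<noteq> b"
    show "set (Q a) \<inter> set (Q b) = {}"
    proof (cases "a = 0 \<or> b = 0")
      case False
      then obtain I J where IJ: "I \<in> P" "a = Suc (g I)" "J \<in> P" "b = Suc (g J)"
        using ab B(1) by blast
      then have "set (f I) \<inter> set (f J) = {}"
        using P(4)[of I J] fg[of I] fg[of J] ab(3) by blast
      then show ?thesis using IJ Q by simp
    qed auto
  qed
  moreover have "card (insert 0 B) = Suc m"
    using B P(1) finite_subset[OF B(1)] by (subst card_insert_disjoint) auto
  ultimately show ?thesis by blast
qed

text \<open>
  A local version, for paths, of Kouider's theorem that a cycle can be found whose removal lowers
  the independence number by the connectivity. Truncated subtraction covers the case that a
  path contains all of \<open>S\<close>. The induction removes a vertex \<open>v\<close> from \<open>S\<close>: if the path obtained for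
  the smaller set does not work for \<open>S\<close>, this can only be because it misses \<open>v\<close>, and \<open>v\<close> is then
  critical in the sense of the locale above.
\<close>
theorem path_reducing_independence:
  assumes "S \<subseteq> pverts G"
    and "\<And>x y. x \<in> S \<Longrightarrow> y \<in> S \<Longrightarrow> x \<noteq> y \<Longrightarrow> disjointly_joined G m x y"
  shows "\<exists>p. simple_path G p \<and> \<alpha> (S - set p) \<le> \<alpha> S - Suc m"
proof -
  have "finite S" using assms(1) finite_subset pair_finite_verts by blast
  then show ?thesis
    using assms
  proof (induction S rule: finite_induct)
    case empty
    then show ?case using simple_path_Nil by fastforce
  next
    case (insert v S)
    obtain p0 where p0: "simple_path G p0" "\<alpha> (S - set p0) \<le> \<alpha> S - Suc m"
      using insert.IH insert.prems by blast
    define t where "t = \<alpha> (insert v S) - Suc m"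
    have p0_t: "\<alpha> (S - set p0) \<le> t"
      using p0(2) independence_number_mono[of S "insert v S"] unfolding t_def by fastforce
    show ?case
    proof (rule ccontr)
      assume "\<not> ?case"
      then have t_less: "t < \<alpha> (insert v S - set xs)" if "simple_path G xs" for xs
        using that unfolding t_def not_le[symmetric] by blast
      have missing: False if "simple_path G xs" "insert v S - set xs \<subseteq> S - set p0" for xs
        using t_less[OF that(1)] independence_number_mono[OF that(2)] p0_t by linarith
      have v_p0: "v \<notin> set p0"
        using missing[OF p0(1)] by blast
      \<comment> \<open>The disjoint paths are available only between vertices of \<open>S\<close>, so the path must start in \<open>S\<close>.\<close>
      define p where "p = dropWhile (\<lambda>x. x \<notin> insert v S) p0"
      have p0_split: "p0 = takeWhile (\<lambda>x. x \<notin> insert v S) p0 @ p"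
        unfolding p_def by simp
      have p: "simple_path G p"
        using p0(1) p0_split simple_path_append by metis
      have p_sub: "set p \<subseteq> set p0" using p0_split by (metis Un_upper2 set_append)
      have "set p0 \<inter> insert v S \<subseteq> set p"
      proof
        fix x assume x: "x \<in> set p0 \<inter> insert v S"
        then have "x \<notin> set (takeWhile (\<lambda>x. x \<notin> insert v S) p0)"
          using set_takeWhileD by fastforce
        then show "x \<in> set p"
          using x p0_split by (metis IntD1 Un_iff set_append)
      qed
      then have same: "insert v S - set p = insert v S - set p0"
        using p_sub by blast
      have v: "v \<in> pverts G" "v \<notin> set p"
        using insert.prems v_p0 p_sub by auto
      have p_ne: "p \<noteq> []"
      proof
        assume "p = []"
        then have "insert v S - set [v] \<subseteq> S - set p0" using same by auto
        then show False using missing[of "[v]"] v by (simp add: simple_path_Cons)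
      qed
      have hd_S: "hd p \<in> insert v S"
        using p_ne hd_dropWhile unfolding p_def by blast
      have hd_v: "hd p \<noteq> v" using p_ne v by auto
      \<comment> \<open>A direct connection to the first vertex would allow \<open>p\<close> to be extended by \<open>v\<close>.\<close>
      have no_spoke: False
        if L: "simple_path G (v # L @ [hd p])" "set L \<inter> set p = {}" for L
      proof (rule missing)
        have "simple_path G (v # L)" "(last (v # L), hd p) \<in> parcs G"
          using L(1) simple_path_append[of G "v # L" "[hd p]"] by auto
        then show "simple_path G ((v # L) @ p)"
          unfolding simple_path_append using p L(2) v by auto
        show "insert v S - set ((v # L) @ p) \<subseteq> S - set p0"
          using same by auto
      qed
      define fans where "fans = (\<lambda>(A, Q). fan G p v A Q \<and> card A = Suc m)"
      have "disjointly_joined G m v (hd p)"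
        using insert.prems(2)[of v "hd p"] hd_S hd_v by auto
      then have "\<exists>A Q. fan G p v A Q \<and> card A = Suc m"
        by (rule fan_exists[OF p p_ne v]) (rule no_spoke)
      then obtain A0 Q0 where "fans (A0, Q0)"
        unfolding fans_def by auto
      moreover have "\<forall>AQ. fans AQ \<longrightarrow> \<Sum>(fst AQ) < Suc (\<Sum>{..length p})"
        unfolding fans_def fan_def less_Suc_eq_le by (auto intro!: sum_mono2)
      ultimately have "\<exists>AQ. fans AQ \<and> (\<forall>AQ'. fans AQ' \<longrightarrow> \<Sum>(fst AQ') \<le> \<Sum>(fst AQ))"
        by (rule ex_has_greatest_nat[where f = "\<lambda>AQ. \<Sum>(fst AQ)"])
      then obtain AQ where max: "fans AQ" "\<And>AQ'. fans AQ' \<Longrightarrow> \<Sum>(fst AQ') \<le> \<Sum>(fst AQ)"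
        by blast
      obtain A Q where [simp]: "AQ = (A, Q)" by (cases AQ)
      have AQ: "fan G p v A Q" "card A = Suc m"
        using max(1) unfolding fans_def by auto
      interpret saturated_fan G "insert v S" t p v A Q
      proof
        show "insert v S \<subseteq> pverts G" by (rule insert.prems)
        have "insert v S - set p - {v} = S - set p0"
          using same insert.hyps(2) v_p0 by blast
        then show "\<alpha> (insert v S - set p - {v}) \<le> t" using p0_t by simp
        show "\<Sum>A' \<le> \<Sum>A" if "fan G p v A' Q'" "card A' = card A" for A' Q'
          using max(2)[of "(A', Q')"] AQ that unfolding fans_def by simp
      qed (use t_less p v AQ in auto)
      show False
        using independence_number_ge AQ(2) unfolding t_def by simp
    qed
  qed
qed

end

section \<open>Growing trees by pendant paths\<close>

definition add_pendant :: "'a pair_pre_digraph \<Rightarrow> 'a \<Rightarrow> 'a \<Rightarrow> 'a pair_pre_digraph" where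
  "add_pendant T u w =
     \<lparr>pverts = insert w (pverts T), parcs = parcs T \<union> {(u, w), (w, u)}\<rparr>"

lemma add_pendant_simps [simp]:
  "pverts (add_pendant T u w) = insert w (pverts T)"
  "parcs (add_pendant T u w) = parcs T \<union> {(u, w), (w, u)}"
  by (simp_all add: add_pendant_def)

lemma pair_graph_add_pendant:
  assumes "pair_graph T" "u \<in> pverts T" "w \<notin> pverts T"
  shows "pair_graph (add_pendant T u w)"
proof -
  interpret T: pair_graph T by fact
  have "symmetric (with_proj (add_pendant T u w))"
    using T.arcs_symmetric unfolding symmetric_def by (auto intro!: symI)
  then show ?thesis
    using assms(2,3) T.pair_finite_verts T.pair_finite_arcs
    by unfold_locales (auto dest: T.in_arcsD1 T.in_arcsD2 T.no_loops')
qed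

lemma connected_pair_graphI:
  assumes "pair_graph T" "r \<in> pverts T" "\<And>x. x \<in> pverts T \<Longrightarrow> r \<rightarrow>\<^sup>*\<^bsub>with_proj T\<^esub> x"
  shows "connected (with_proj T)"
proof -
  interpret T: pair_graph T by fact
  show ?thesis
  proof (rule T.connectedI)
    fix x y assume "x \<in> pverts T" "y \<in> pverts T"
    then have "x \<rightarrow>\<^sup>*\<^bsub>with_proj T\<^esub> r" "r \<rightarrow>\<^sup>*\<^bsub>with_proj T\<^esub> y"
      using assms(3) symmetric_reachable[OF T.sym_arcs] by auto
    then have "x \<rightarrow>\<^sup>*\<^bsub>with_proj T\<^esub> y"
      by (rule T.reachable_trans)
    then show "x \<rightarrow>\<^sup>*\<^bsub>mk_symmetric (with_proj T)\<^esub> y"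
      by (rule T.reachable_mk_symmetricI)
  qed (use assms(2) in auto)
qed

lemma connected_add_pendant:
  assumes "pair_graph T" "connected (with_proj T)" "u \<in> pverts T" "w \<notin> pverts T"
  shows "connected (with_proj (add_pendant T u w))"
proof (rule connected_pair_graphI[where r = u])
  let ?T = "add_pendant T u w"
  show pg: "pair_graph ?T" by (rule pair_graph_add_pendant[OF assms(1,3,4)])
  interpret T: pair_graph T by fact
  interpret T': pair_graph ?T by fact
  have sub: "subgraph (with_proj T) (with_proj ?T)"
    using T.wf_digraph T'.wf_digraph by (auto simp: subgraph_def compatible_def)
  have sc: "strongly_connected (with_proj T)"
    using assms(2) T.symmetric_connected_imp_strongly_connected[OF T.sym_arcs] by simp
  show "u \<rightarrow>\<^sup>*\<^bsub>with_proj ?T\<^esub> x" if "x \<in> pverts ?T" for x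
  proof (cases "x = w")
    case True
    then show ?thesis by (intro T'.reachable_adjI) auto
  next
    case False
    then have "u \<rightarrow>\<^sup>*\<^bsub>with_proj T\<^esub> x"
      using that sc assms(3) by (auto simp: strongly_connected_def)
    then show ?thesis
      by (rule pre_digraph.reachable_mono[OF _ sub])
  qed
qed (use assms(3) in auto)

lemma pcas_nth: "pcas u p v \<Longrightarrow> Suc i < length p \<Longrightarrow> snd (p ! i) = fst (p ! Suc i)"
proof (induction p arbitrary: u i)
  case (Cons a p)
  then show ?case by (cases i; cases p) auto
qed simp

lemma pcas_ends: "pcas u p v \<Longrightarrow> p \<noteq> [] \<Longrightarrow> fst (p ! 0) = u \<and> snd (p ! (length p - 1)) = v"
proof (induction p arbitrary: u)
  case (Cons a p)
  then show ?case by (cases p) auto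
qed simp

text \<open>
  A closed walk through \<open>w\<close> must enter and leave \<open>w\<close> by the arcs \<open>(u, w)\<close> and \<open>(w, u)\<close>. It then
  enters \<open>u\<close> both just before and just after the visit to \<open>w\<close>, which in a cycle are the same
  step only if the length is two.
\<close>
lemma acyclic_add_pendant:
  assumes "pair_graph T" "u \<in> pverts T" "w \<notin> pverts T"
    and p: "pre_digraph.cycle (with_proj (add_pendant T u w)) p" "length p \<ge> 3"
  shows "pre_digraph.cycle (with_proj T) p"
proof -
  let ?T = "add_pendant T u w"
  interpret T: pair_graph T by fact
  interpret T': pair_graph ?T by (rule pair_graph_add_pendant[OF assms(1-3)])
  obtain x where x: "T'.awalk x p x" "distinct (tl (pawalk_verts x p))" "p \<noteq> []"
    using p(1) unfolding T'.cycle_def by auto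
  have cas: "pcas x p x" and arcs: "set p \<subseteq> parcs ?T"
    using x(1) unfolding T'.awalk_def by auto
  have "tl (pawalk_verts x p) = map snd p"
    using T'.awalk_verts_conv'[OF cas] x(3) by simp
  then have inj: "i = j" if "i < length p" "j < length p" "snd (p ! i) = snd (p ! j)" for i j
    using x(2) that nth_eq_iff_index_eq[of "map snd p" i j] by simp
  define next_i where "next_i i = (if Suc i = length p then 0 else Suc i)" for i
  have next_arc: "snd (p ! i) = fst (p ! next_i i)" if "i < length p" for i
  proof (cases "Suc i = length p")
    case True
    then have "i = length p - 1" by simp
    then show ?thesis
      using pcas_ends[OF cas x(3)] True unfolding next_i_def by simp
  next
    case False
    then show ?thesis
      using pcas_nth[OF cas, of i] that unfolding next_i_def by simp
  qed
  have next_less: "next_i i < length p" if "i < length p" for i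
    using that unfolding next_i_def by auto
  have prev: "\<exists>j<length p. next_i j = i" if "i < length p" for i
    using that unfolding next_i_def
    by (cases i) (auto intro: exI[of _ "length p - 1"] exI[of _ "i - 1"])
  have arc: "p ! i \<in> parcs ?T" if "i < length p" for i
    using arcs that nth_mem by blast
  have old: "fst e \<noteq> w \<and> snd e \<noteq> w" if "e \<in> parcs T" for e
    using that assms(3) T.arc_fst_in_verts T.arc_snd_in_verts by metis
  have enter: "snd (p ! i) \<noteq> w" if i: "i < length p" for i
  proof
    assume w: "snd (p ! i) = w"
    have pi: "p ! i = (u, w)"
      using arc[OF i] old[of "p ! i"] w assms(2,3) by (cases "p ! i") auto
    have pn: "p ! next_i i = (w, u)"
      using arc[OF next_less[OF i]] old[of "p ! next_i i"] next_arc[OF i] w assms(2,3)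
        by (cases "p ! next_i i") auto
    obtain j where j: "j < length p" "next_i j = i"
      using prev[OF i] by blast
    have "snd (p ! j) = snd (p ! next_i i)"
      using next_arc[OF j(1)] j(2) pi pn by simp
    then have "j = next_i i"
      using inj j(1) next_less[OF i] by blast
    then show False
      using j p(2) i unfolding next_i_def by (auto split: if_splits)
  qed
  have leave: "fst (p ! i) \<noteq> w" if "i < length p" for i
    using prev[OF that] next_arc enter by metis
  have in_T: "set p \<subseteq> parcs T"
  proof
    fix e assume "e \<in> set p"
    then obtain i where "i < length p" "e = p ! i" by (auto simp: in_set_conv_nth)
    then show "e \<in> parcs T" using arc[of i] enter[of i] leave[of i] by auto
  qed
  have "p ! 0 \<in> parcs T" using in_T x(3) by auto
  then have "x \<in> pverts T"
    using pcas_ends[OF cas x(3)] T.arc_fst_in_verts by auto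
  then have "T.awalk x p x"
    using in_T cas unfolding T.awalk_def by simp
  then show ?thesis
    using x unfolding T.cycle_def by auto
qed

lemma undirected_tree_add_pendant:
  assumes "undirected_tree T" "u \<in> pverts T" "w \<notin> pverts T"
  shows "undirected_tree (add_pendant T u w)"
proof -
  have T: "pair_graph T" "connected (with_proj T)"
    and acyclic: "\<And>p. pre_digraph.cycle (with_proj T) p \<Longrightarrow> \<not> length p \<ge> 3"
    using assms(1) unfolding undirected_tree_def by simp_all
  have "\<not> length p \<ge> 3" if "pre_digraph.cycle (with_proj (add_pendant T u w)) p" for p
    using acyclic acyclic_add_pendant[OF T(1) assms(2,3) that] by metis
  then show ?thesis
    using pair_graph_add_pendant[OF T(1) assms(2,3)] connected_add_pendant[OF T assms(2,3)]
    unfolding undirected_tree_def by simp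
qed

text \<open>
  Except possibly for the root \<open>r\<close>, the vertex \<open>u\<close> has another neighbour and hence ceases to be
  a leaf (if it was one).
\<close>
lemma leaves_add_pendant:
  assumes "pair_graph T" "w \<notin> pverts T"
    and u: "u = r \<or> (\<exists>x. (u, x) \<in> parcs T)"
  shows "leaves (add_pendant T u w) \<subseteq> insert r (insert w (leaves T - {u}))"
proof
  interpret T: pair_graph T by fact
  fix x assume x: "x \<in> leaves (add_pendant T u w)"
  have deg: "card (out_arcs (with_proj (add_pendant T u w)) x) = 1"
    using x unfolding leaves_def out_degree_def by simp
  show "x \<in> insert r (insert w (leaves T - {u}))"
  proof (cases "x = w \<or> x = r")
    case False
    have "x \<noteq> u"
    proof
      assume "x = u"
      then obtain y where y: "(u, y) \<in> parcs T" using u False by blast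
      have "y \<noteq> w" using y assms(2) T.in_arcsD2 by blast
      moreover have "{(u, y), (u, w)} \<subseteq> out_arcs (with_proj (add_pendant T u w)) x"
        using y \<open>x = u\<close> by (auto simp: out_arcs_def)
      ultimately show False
        using deg by (metis card_1_singletonE insert_subset prod.inject singletonD)
    qed
    then have "out_arcs (with_proj (add_pendant T u w)) x = out_arcs (with_proj T) x"
      using False by (auto simp: out_arcs_def)
    then show ?thesis
      using x False \<open>x \<noteq> u\<close> unfolding leaves_def out_degree_def by auto
  qed blast
qed

text \<open>
  The set \<open>L\<close> is an upper bound for the leaves. The root \<open>r\<close> stays in it forever: this
  absorbs the tree with one vertex, which has no leaf but gains two with its first edge.
\<close>
inductive grown_tree :: "'a pair_pre_digraph \<Rightarrow> 'a \<Rightarrow> 'a pair_pre_digraph \<Rightarrow> 'a set \<Rightarrow> bool"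
  for G :: "'a pair_pre_digraph" and r :: 'a where
  root: "r \<in> pverts G \<Longrightarrow> grown_tree G r \<lparr>pverts = {r}, parcs = {}\<rparr> {r}"
| pendant: "grown_tree G r T L \<Longrightarrow> u \<in> pverts T \<Longrightarrow> w \<notin> pverts T \<Longrightarrow> (u, w) \<in> parcs G \<Longrightarrow>
    grown_tree G r (add_pendant T u w) (insert r (insert w (L - {u})))"

lemma grown_tree_ends: "grown_tree G r T L \<Longrightarrow> finite L \<and> r \<in> L"
  by (induction rule: grown_tree.induct) auto

lemma undirected_tree_singleton: "undirected_tree \<lparr>pverts = {r}, parcs = {}\<rparr>"
proof -
  let ?T = "\<lparr>pverts = {r}, parcs = {}\<rparr>"
  have pg: "pair_graph ?T"
    by unfold_locales (auto simp: symmetric_def sym_def)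
  interpret T: pair_graph ?T by fact
  have "connected (with_proj ?T)"
    by (rule connected_pair_graphI[OF pg, of r]) auto
  moreover have "\<not> T.cycle p" for p
  proof
    assume "T.cycle p"
    then obtain x where "T.awalk x p x" "p \<noteq> []"
      unfolding T.cycle_def by blast
    then show False by (cases p) (simp_all add: T.awalk_def)
  qed
  ultimately show ?thesis
    using pg unfolding undirected_tree_def by simp
qed

lemma grown_tree_undirected_tree: "grown_tree G r T L \<Longrightarrow> undirected_tree T"
proof (induction rule: grown_tree.induct)
  case root
  show ?case by (rule undirected_tree_singleton)
next
  case (pendant T L u w)
  show ?case by (rule undirected_tree_add_pendant) fact+
qed

lemma grown_tree_leaves: "grown_tree G r T L \<Longrightarrow> leaves T \<subseteq> L"
proof -
  assume "grown_tree G r T L"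
  then have "leaves T \<subseteq> L \<and> (\<forall>u\<in>pverts T. u = r \<or> (\<exists>x. (u, x) \<in> parcs T))"
  proof (induction rule: grown_tree.induct)
    case root
    then show ?case by (auto simp: leaves_def)
  next
    case (pendant T L u w)
    have "pair_graph T"
      using grown_tree_undirected_tree[OF pendant(1)] unfolding undirected_tree_def by blast
    then have "leaves (add_pendant T u w) \<subseteq> insert r (insert w (leaves T - {u}))"
      using leaves_add_pendant pendant by metis
    then show ?case using pendant.IH by auto
  qed
  then show ?thesis by blast
qed

context pair_graph
begin

lemma grown_tree_sub: "grown_tree G r T L \<Longrightarrow> pverts T \<subseteq> pverts G \<and> parcs T \<subseteq> parcs G"
  by (induction rule: grown_tree.induct) (auto intro: arcs_symmetric dest: in_arcsD2)

lemma grown_tree_subgraph: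
  assumes "grown_tree G r T L"
  shows "subgraph (with_proj T) (with_proj G)"
proof -
  interpret T: pair_graph T
    using grown_tree_undirected_tree[OF assms] unfolding undirected_tree_def by blast
  show ?thesis
    using grown_tree_sub[OF assms] wf_digraph T.wf_digraph
    by (auto simp: subgraph_def compatible_def)
qed

text \<open>
  Apart from the root, only the last vertex of \<open>Q\<close> becomes a new leaf. That \<open>u\<close> is removed matters when a path is built
  up from its first vertex.
\<close>
lemma grown_tree_attach_path:
  assumes "grown_tree G r T L" "u \<in> pverts T" "Q \<noteq> []" "simple_path G Q"
    "set Q \<inter> pverts T = {}" "(u, hd Q) \<in> parcs G"
  shows "\<exists>T' L'. grown_tree G r T' L' \<and> pverts T' = pverts T \<union> set Q \<and>
    L' \<subseteq> insert r (insert (last Q) (L - {u}))"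
  using assms
proof (induction Q arbitrary: T L u)
  case (Cons q Q)
  let ?T = "add_pendant T u q" and ?L = "insert r (insert q (L - {u}))"
  have grown: "grown_tree G r ?T ?L"
    using Cons.prems by (intro grown_tree.pendant) auto
  show ?case
  proof (cases "Q = []")
    case True
    then show ?thesis using grown by fastforce
  next
    case False
    obtain T' L' where "grown_tree G r T' L'" "pverts T' = pverts ?T \<union> set Q"
      "L' \<subseteq> insert r (insert (last Q) (?L - {q}))"
      using Cons.IH[OF grown, of q] Cons.prems False by (auto simp: simple_path_Cons)
    moreover have "insert r (insert (last Q) (?L - {q})) \<subseteq> insert r (insert (last Q) (L - {u}))"
      by blast
    ultimately show ?thesis
      using False by (intro exI[of _ T'] exI[of _ L']) auto
  qed
qed simp

lemma grown_tree_of_path: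
  assumes "simple_path G p" "p \<noteq> []"
  shows "\<exists>T L. grown_tree G (hd p) T L \<and> pverts T = set p \<and> card L \<le> 2"
proof -
  obtain r q where p: "p = r # q" using assms(2) by (cases p) auto
  have root: "grown_tree G r \<lparr>pverts = {r}, parcs = {}\<rparr> {r}"
    using assms(1) p by (intro grown_tree.root) (simp add: simple_path_Cons)
  show ?thesis
  proof (cases "q = []")
    case True
    then show ?thesis using root p by fastforce
  next
    case False
    then obtain T L where TL: "grown_tree G r T L" "pverts T = {r} \<union> set q"
      "L \<subseteq> insert r (insert (last q) ({r} - {r}))"
      using grown_tree_attach_path[OF root, of r q] assms(1) p by (auto simp: simple_path_Cons)
    have "card L \<le> card {r, last q}"
      using TL(3) by (intro card_mono) auto
    also have "\<dots> \<le> 2" by (simp add: card_insert_if)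
    finally show ?thesis using TL p by auto
  qed
qed

lemma apath_simple_path:
  assumes "apath x p y"
  shows "simple_path G (pawalk_verts x p)" "hd (pawalk_verts x p) = x" "last (pawalk_verts x p) = y"
proof -
  have w: "awalk x p y" and d: "distinct (pawalk_verts x p)"
    using assms unfolding apath_def by auto
  have "successively (\<lambda>a b. (a, b) \<in> parcs G) (pawalk_verts x p)"
    if "pcas x p y" "set p \<subseteq> parcs G" for x
    using that
  proof (induction p arbitrary: x)
    case (Cons a p)
    then show ?case by (cases p) (auto simp: successively_Cons)
  qed simp
  then show "simple_path G (pawalk_verts x p)" "hd (pawalk_verts x p) = x" "last (pawalk_verts x p) = y"
    using w d unfolding simple_path_def by (auto elim!: awalkE)
qed

lemma connected_simple_path:
  assumes "connected (with_proj G)" "x \<in> pverts G" "y \<in> pverts G"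
  obtains xs where "simple_path G xs" "xs \<noteq> []" "hd xs = x" "last xs = y"
proof -
  have "strongly_connected (with_proj G)"
    using assms(1) symmetric_connected_imp_strongly_connected[OF sym_arcs] by simp
  then have "x \<rightarrow>\<^sup>*\<^bsub>with_proj G\<^esub> y"
    using assms(2,3) by (auto simp: strongly_connected_def)
  then obtain p where p: "apath x p y"
    using reachable_apath by blast
  then have "pawalk_verts x p \<noteq> []" by (cases p) auto
  then show thesis using apath_simple_path[OF p] that by blast
qed

text \<open>
  As long as \<open>S\<close> is not covered, attach a path that ends in \<open>S\<close> and meets as many vertices of \<open>S\<close>
  as possible. This costs one leaf. Its last vertex is not adjacent to any vertex of \<open>S\<close> still
  uncovered, since the path could be prolonged by such a vertex; thus it can be added to
  every independent set of the remainder, and the independence number of the remainder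
  has dropped.
\<close>
lemma grown_tree_cover:
  assumes conn: "connected (with_proj G)" and S: "S \<subseteq> pverts G"
    and "grown_tree G r T L"
  shows "\<exists>T' L'. grown_tree G r T' L' \<and> pverts T \<union> S \<subseteq> pverts T' \<and>
    card L' \<le> card L + \<alpha> (S - pverts T)"
  using assms(3)
proof (induction "card (S - pverts T)" arbitrary: T L rule: less_induct)
  case less
  have fin: "finite S" using S finite_subset pair_finite_verts by blast
  show ?case
  proof (cases "S \<subseteq> pverts T")
    case True
    then show ?thesis using less.prems by fastforce
  next
    case False
    define twig where "twig Q \<longleftrightarrow> Q \<noteq> [] \<and> simple_path G Q \<and> set Q \<inter> pverts T = {} \<and>
      (\<exists>u\<in>pverts T. (u, hd Q) \<in> parcs G) \<and> last Q \<in> S" for Q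
    obtain s where s: "s \<in> S" "s \<notin> pverts T" using False by blast
    have r: "r \<in> pverts T" using less.prems by (induction rule: grown_tree.induct) auto
    obtain xs where xs: "simple_path G xs" "xs \<noteq> []" "hd xs = r" "last xs = s"
      using connected_simple_path[OF conn, of r s] r grown_tree_sub[OF less.prems] s S by blast
    have "\<exists>x\<in>set xs. x \<in> pverts T" using xs r hd_in_set by metis
    then obtain B u Q0 where split: "xs = B @ u # Q0" "u \<in> pverts T" "\<forall>z\<in>set Q0. z \<notin> pverts T"
      using split_list_last_prop[of xs "\<lambda>x. x \<in> pverts T"] by blast
    have "Q0 \<noteq> []" using split xs(4) s by auto
    then have "twig Q0"
      using xs s split unfolding twig_def by (auto simp: simple_path_append simple_path_Cons)
    moreover have "\<forall>Q. twig Q \<longrightarrow> card (set Q \<inter> S) < Suc (card S)"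
      using fin by (simp add: card_mono less_Suc_eq_le)
    ultimately have "\<exists>Q. twig Q \<and> (\<forall>Q'. twig Q' \<longrightarrow> card (set Q' \<inter> S) \<le> card (set Q \<inter> S))"
      by (rule ex_has_greatest_nat[where f = "\<lambda>Q. card (set Q \<inter> S)"])
    then obtain Q where Q: "twig Q"
      "\<And>Q'. twig Q' \<Longrightarrow> card (set Q' \<inter> S) \<le> card (set Q \<inter> S)"
      by blast
    obtain u where u: "u \<in> pverts T" "(u, hd Q) \<in> parcs G"
      using Q(1) unfolding twig_def by blast
    obtain T1 L1 where T1: "grown_tree G r T1 L1" "pverts T1 = pverts T \<union> set Q"
      "L1 \<subseteq> insert r (insert (last Q) (L - {u}))"
      using grown_tree_attach_path[OF less.prems u(1)] Q(1) u unfolding twig_def by blast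
    \<comment> \<open>The root is already in \<open>L\<close>, so only the end of \<open>Q\<close> can be new.\<close>
    have "L1 \<subseteq> insert (last Q) L"
      using T1(3) grown_tree_ends[OF less.prems] by blast
    then have "card L1 \<le> card (insert (last Q) L)"
      using grown_tree_ends[OF less.prems] by (intro card_mono) auto
    also have "\<dots> \<le> Suc (card L)" by (simp add: card_insert_le_m1 card_insert_if)
    finally have L1: "card L1 \<le> Suc (card L)" .
    have last: "last Q \<in> S" "last Q \<in> set Q" "last Q \<notin> pverts T"
    proof -
      show "last Q \<in> S" "last Q \<in> set Q" using Q(1) unfolding twig_def by auto
      then show "last Q \<notin> pverts T" using Q(1) unfolding twig_def by blast
    qed
    obtain I where I: "I \<subseteq> S - pverts T1" "independent G I" "card I = \<alpha> (S - pverts T1)"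
      by (rule maximum_independent_obtain)
    have nonadj: "(last Q, w) \<notin> parcs G" if w: "w \<in> I" for w
    proof
      assume arc: "(last Q, w) \<in> parcs G"
      have wS: "w \<in> S" "w \<notin> pverts T" "w \<notin> set Q" using w I(1) T1(2) by auto
      have "twig (Q @ [w])"
        using Q(1) wS S arc unfolding twig_def
        by (auto simp: simple_path_append simple_path_Cons)
      then have "card (set (Q @ [w]) \<inter> S) \<le> card (set Q \<inter> S)" by (rule Q(2))
      moreover have "set (Q @ [w]) \<inter> S = insert w (set Q \<inter> S)" using wS by auto
      ultimately show False using wS by simp
    qed
    have "independent G (insert (last Q) I)"
      using I(2) nonadj arcs_symmetric no_loops' last(1) S unfolding independent_def by blast
    then have "card (insert (last Q) I) \<le> \<alpha> (S - pverts T)"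
      using I(1) last T1(2) by (intro card_independent_le) auto
    moreover have "last Q \<notin> I" using I(1) last T1(2) by blast
    ultimately have alpha_drop: "Suc (\<alpha> (S - pverts T1)) \<le> \<alpha> (S - pverts T)"
      using I(3) independent_finite[OF I(2)] by simp
    have "S - pverts T1 \<subset> S - pverts T" using last T1(2) by blast
    then have "card (S - pverts T1) < card (S - pverts T)"
      using fin by (intro psubset_card_mono) auto
    then obtain T' L' where "grown_tree G r T' L'" "pverts T1 \<union> S \<subseteq> pverts T'"
      "card L' \<le> card L1 + \<alpha> (S - pverts T1)"
      using less.hyps T1(1) by blast
    then show ?thesis
      using T1(2) L1 alpha_drop by (intro exI[of _ T'] exI[of _ L']) auto
  qed
qed

end

section \<open>Local connectivity and the main result\<close>

lemma pcas_zip: "pcas u p v \<Longrightarrow> p = zip (pawalk_verts u p) (tl (pawalk_verts u p))"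
proof (induction p arbitrary: u)
  case (Cons a p)
  obtain b where a: "a = (u, b)" and p: "pcas b p v"
    using Cons.prems by (cases a) auto
  have V: "pawalk_verts b p = b # tl (pawalk_verts b p)"
    using p by (cases p) auto
  have "zip (pawalk_verts u (a # p)) (tl (pawalk_verts u (a # p))) =
      zip (u # pawalk_verts b p) (b # tl (pawalk_verts b p))"
    using a V by simp
  also have "\<dots> = a # p"
    using a Cons.IH[OF p] by simp
  finally show ?case by simp
qed simp

lemma (in pair_graph) disjointly_joined_local_connectivity:
  assumes "x \<noteq> y"
  shows "disjointly_joined G (local_connectivity G x y) x y"
proof -
  let ?C = "{card P | P. internally_disjoint_paths G x y P}"
  have sub: "P \<subseteq> {p. apath x p y}" if "internally_disjoint_paths G x y P" for P
    using that unfolding internally_disjoint_paths_def by auto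
  have "?C \<subseteq> card ` Pow {p. apath x p y}" using sub by blast
  then have fin: "finite ?C" using finite_subset apaths_finite by blast
  have "card {} \<in> ?C" by (force simp: internally_disjoint_paths_def)
  then have "Max ?C \<in> ?C" using fin by (intro Max_in) auto
  then obtain P where P: "internally_disjoint_paths G x y P" "card P = local_connectivity G x y"
    unfolding local_connectivity_def by auto
  have verts: "pawalk_verts x p = x # inner_verts p @ [y]" if "p \<in> P" for p
  proof -
    have a: "apath x p y" using that sub[OF P(1)] by blast
    then have p_ne: "p \<noteq> []" using assms by (auto simp: apath_Nil_iff)
    have "pawalk_verts x p \<noteq> []" "tl (pawalk_verts x p) \<noteq> []"
      using p_ne by (cases p; cases "tl p"; force)+
    moreover have "inner_verts p = butlast (tl (pawalk_verts x p))"
      using inner_verts_conv[of p x] by simp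
    ultimately show ?thesis
      using apath_simple_path(2,3)[OF a] by (metis append_butlast_last_id last_tl list.collapse)
  qed
  have inj: "inj_on inner_verts P"
  proof (rule inj_onI)
    fix p q assume pq: "p \<in> P" "q \<in> P" "inner_verts p = inner_verts q"
    then have "pawalk_verts x p = pawalk_verts x q" using verts by simp
    moreover have "pcas x p y" "pcas x q y"
      using pq sub[OF P(1)] unfolding apath_def awalk_def by auto
    ultimately show "p = q" using pcas_zip by metis
  qed
  have "finite P" using sub[OF P(1)] apaths_finite finite_subset by blast
  then show ?thesis
    unfolding disjointly_joined_def
  proof (intro exI[of _ "inner_verts ` P"] conjI ballI impI)
    show "local_connectivity G x y \<le> card (inner_verts ` P)"
      using P(2) card_image[OF inj] by simp
  next
    fix I assume "I \<in> inner_verts ` P"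
    then obtain p where p: "p \<in> P" "I = inner_verts p" by blast
    then have "apath x p y" using sub[OF P(1)] by blast
    then show "simple_path G (x # I @ [y])"
      using apath_simple_path(1) verts p by metis
  next
    fix I J assume IJ: "I \<in> inner_verts ` P" "J \<in> inner_verts ` P" "I \<noteq> J"
    then obtain p q where pq: "p \<in> P" "I = inner_verts p" "q \<in> P" "J = inner_verts q"
      by blast
    then have "p \<noteq> q" using IJ(3) by blast
    then show "set I \<inter> set J = {}"
      using P(1) pq unfolding internally_disjoint_paths_def by simp
  qed simp
qed

theorem theorem1p5:
  fixes G :: "'a pair_pre_digraph" and S :: "'a set" and k :: nat
  assumes "pair_graph G"
    and "connected (with_proj G)"
    and "k \<ge> 2"
    and "S \<subseteq> pverts G"
    and "enat (independence_number G S) \<le> enat k + set_connectivity G S - 1"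
  shows "\<exists>T. subgraph (with_proj T) (with_proj G) \<and> k_ended_tree k T \<and> S \<subseteq> pverts T"
proof -
  interpret pair_graph G by fact
  have fin: "finite S" using assms(4) finite_subset pair_finite_verts by blast
  obtain g where g: "g \<in> pverts G"
    using assms(2) unfolding connected_def strongly_connected_def mk_symmetric_def by auto
  have "\<exists>p. simple_path G p \<and> \<alpha> (S - set p) \<le> k - 2"
  proof (cases "card S \<ge> 2")
    case True
    let ?K = "{local_connectivity G x y | x y. x \<in> S \<and> y \<in> S \<and> x \<noteq> y}"
    define m where "m = Min ?K"
    have "?K \<subseteq> (\<lambda>(x, y). local_connectivity G x y) ` (S \<times> S)" by auto
    then have "finite ?K" using fin finite_subset by blast
    then have m_le: "m \<le> local_connectivity G x y" if "x \<in> S" "y \<in> S" "x \<noteq> y" for x y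
      using that unfolding m_def by (intro Min_le) auto
    have "disjointly_joined G m x y" if "x \<in> S" "y \<in> S" "x \<noteq> y" for x y
      using disjointly_joined_local_connectivity[OF that(3)] m_le[OF that]
      unfolding disjointly_joined_def by (meson order_trans)
    then obtain p where "simple_path G p" "\<alpha> (S - set p) \<le> \<alpha> S - Suc m"
      using path_reducing_independence[OF assms(4)] by blast
    moreover have "\<alpha> S \<le> k + m - 1"
      using assms(5) True unfolding set_connectivity_def m_def[symmetric] by (simp add: one_enat_def)
    ultimately show ?thesis by (intro exI[of _ p]) auto
  next
    case False
    then have "S = {} \<or> (\<exists>s. S = {s})"
      using fin by (cases "card S") (auto simp: card_Suc_eq not_le less_Suc_eq numeral_2_eq_2)
    then obtain s where "S \<subseteq> {s}" "s \<in> pverts G" using g assms(4) by auto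
    then show ?thesis by (intro exI[of _ "[s]"]) (auto simp: simple_path_Cons Diff_eq_empty_iff[THEN iffD2])
  qed
  then obtain p0 where p0: "simple_path G p0" "\<alpha> (S - set p0) \<le> k - 2" by blast
  obtain p where p: "simple_path G p" "p \<noteq> []" "\<alpha> (S - set p) \<le> k - 2"
  proof (cases "p0 = []")
    case True
    have "\<alpha> (S - set [g]) \<le> \<alpha> (S - set p0)"
      using True by (intro independence_number_mono) auto
    then show thesis using that[of "[g]"] p0 g by (simp add: simple_path_Cons)
  qed (use p0 that in blast)
  obtain T0 L0 where T0: "grown_tree G (hd p) T0 L0" "pverts T0 = set p" "card L0 \<le> 2"
    using grown_tree_of_path[OF p(1,2)] by blast
  obtain T L where T: "grown_tree G (hd p) T L" "pverts T0 \<union> S \<subseteq> pverts T"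
    "card L \<le> card L0 + \<alpha> (S - pverts T0)"
    using grown_tree_cover[OF assms(2,4) T0(1)] by blast
  have "card (leaves T) \<le> card L"
    using grown_tree_leaves[OF T(1)] grown_tree_ends[OF T(1)] by (simp add: card_mono)
  also have "\<dots> \<le> k" using T(3) T0(2,3) p(3) assms(3) by simp
  finally have "k_ended_tree k T"
    using grown_tree_undirected_tree[OF T(1)] unfolding k_ended_tree_def by blast
  then show ?thesis
    using grown_tree_subgraph[OF T(1)] T(2) by blast
qed

end
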